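(* For every $n\ge 0$, the map $\Phi$ is a bijection from the set $\mathcal{D}_n$ of Dyck paths of length $2n$ to itself.
   Context: A Dyck path of length $2n$ (semilength $n$) is a lattice path from $(0,0)$ to $(2n,0)$ consisting of up-steps $\mathbf{u}=(1,1)$ and down-steps $\mathbf{d}=(1,-1)$ that never goes below the $x$-axis; it is identified with its word in the letters $\mathbf{u},\mathbf{d}$. $\mathcal{D}_n$ is the set of Dyck paths of length $2n$. Matching: each up-step of a Dyck path $D$ is matched with the down-step for which $D=A\mathbf{u}B\mathbf{d}C$ with $B$ a (possibly empty) Dyck path, where the displayed $\mathbf{u}$ and $\mathbf{d}$ are the two matched steps. Definition of $\Phi$: let $\sigma$ be the permutation of $\{1,\dots,2n\}$ with $\sigma_i=\frac{i+1}{2}$ for $i$ odd and $\sigma_i=2n+1-\frac{i}{2}$ for $i$ even (so the order is $1,2n,2,2n-1,3,2n-2,\dots$). For $D\in\mathcal{D}_n$, the word $\Phi(D)$ of length $2n$ is built as follows: for $i=1,\dots,2n$, consider the $\sigma_i$-th step of $D$; if its matching step in $D$ has not yet been read (i.e. is not among the steps numbered $\sigma_1,\dots,\sigma_{i-1}$), the $i$-th step of $\Phi(D)$ is an up-step; otherwise it is a down-step. *)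

theory Defs
  imports Main
begin

datatype step = Up | Down

definition step_val :: "step \<Rightarrow> int" where
  "step_val s = (case s of Up \<Rightarrow> 1 | Down \<Rightarrow> - 1)"

definition height :: "step list \<Rightarrow> int" where
  "height w = sum_list (map step_val w)"

definition dyck_path :: "step list \<Rightarrow> bool" where
  "dyck_path w \<longleftrightarrow> (\<forall>k \<le> length w. 0 \<le> height (take k w)) \<and> height w = 0"

definition dyck_paths :: "nat \<Rightarrow> step list set" where
  "dyck_paths n = {w. length w = 2 * n \<and> dyck_path w}"

(* Steps are numbered from 1: step p of w is w ! (p - 1). *)
definition up_down_match :: "step list \<Rightarrow> nat \<Rightarrow> nat \<Rightarrow> bool" where
  "up_down_match w p q \<longleftrightarrow>
     (\<exists>A B C. w = A @ [Up] @ B @ [Down] @ C \<and> dyck_path B \<and>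
        p = length A + 1 \<and> q = length A + length B + 2)"

definition matched :: "step list \<Rightarrow> nat \<Rightarrow> nat \<Rightarrow> bool" where
  "matched w p q \<longleftrightarrow> up_down_match w p q \<or> up_down_match w q p"

(* Intended for 1 \<le> i \<le> 2 * n, where the natural-number operations are exact. *)
definition sigma :: "nat \<Rightarrow> nat \<Rightarrow> nat" where
  "sigma n i = (if odd i then (i + 1) div 2 else 2 * n + 1 - i div 2)"

definition Phi :: "nat \<Rightarrow> step list \<Rightarrow> step list" where
  "Phi n w = map (\<lambda>i. if \<exists>j. 1 \<le> j \<and> j < i \<and> matched w (sigma n i) (sigma n j) then Down else Up)
     [1..<2 * n + 1]"

end

theory Submission
  imports Defs
begin

text \<open>
  While \<open>Phi\<close> reads a Dyck path alternately from both ends, the unread steps always form a factor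
  \<open>M\<close>. Cancelling matched pairs inside \<open>M\<close> leaves \<open>x\<close> down-steps followed by \<open>y\<close> up-steps
  (\<open>unmatched_downs\<close>, \<open>unmatched_ups\<close>); these are exactly the unread steps whose partner has already
  been read. The next output letter depends on \<open>M\<close> alone: every step of a Dyck path has exactly
  one partner, so the output is \<open>Up\<close> precisely when the step has its partner inside \<open>M\<close>
  (\<open>read_partner_first_iff\<close>, \<open>read_partner_last_iff\<close>). Hence \<open>Phi\<close> is computed by a recursion on the unread
  factor (\<open>Phi_eq_encode\<close>), where mirroring the factor after every step turns the alternation into
  reading always from the left.

  The recursion can be inverted letter by letter because \<open>(x, y)\<close> can be traced from the output.
  On the left end, output \<open>Up\<close> forces the letter \<open>Up\<close> and increases \<open>x\<close>. Output \<open>Down\<close>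
  means that the letter is one of the \<open>x + y\<close> unmatched ones; as the unmatched downs precede the
  unmatched ups, it is \<open>Down\<close> if \<open>x > 0\<close> (and \<open>x\<close> drops) and \<open>Up\<close> if \<open>x = 0\<close> (and \<open>y\<close> drops).
  Starting from \<open>(0, 0)\<close>, the output therefore determines the path (\<open>encode_inject\<close>).
  Moreover the output still to come has height \<open>- (x + y)\<close>
  (\<open>height_encode\<close>), so the output is a Dyck path. An injective self-map of a finite set is
  bijective.
\<close>

section \<open>Unmatched steps of a word\<close>

text \<open>
  The words in \<open>Up\<close> and \<open>Down\<close>, modulo cancellation of \<open>Up Down\<close>, form the bicyclic monoid. The two
  functions below are the exponents of the normal form \<open>Down^x Up^y\<close>.
\<close>

fun unmatched_downs :: "step list \<Rightarrow> nat" where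
  "unmatched_downs [] = 0"
| "unmatched_downs (Up # w) = unmatched_downs w - 1"
| "unmatched_downs (Down # w) = Suc (unmatched_downs w)"

fun unmatched_ups :: "step list \<Rightarrow> nat" where
  "unmatched_ups [] = 0"
| "unmatched_ups (Up # w) =
     (if unmatched_downs w = 0 then Suc (unmatched_ups w) else unmatched_ups w)"
| "unmatched_ups (Down # w) = unmatched_ups w"

lemma unmatched_append:
  "unmatched_downs (v @ w) = unmatched_downs v + (unmatched_downs w - unmatched_ups v)"
  "unmatched_ups (v @ w) = unmatched_ups w + (unmatched_ups v - unmatched_downs w)"
proof (induction v)
  case (Cons c v)
  { case 1 show ?case using Cons by (cases c) auto }
  { case 2 show ?case using Cons by (cases c) auto }
qed auto

lemma height_append: "height (v @ w) = height v + height w"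
  by (simp add: height_def)

lemma height_Cons:
  "height (Up # w) = height w + 1"
  "height (Down # w) = height w - 1"
  by (simp_all add: height_def step_val_def)

lemma height_Nil: "height [] = 0"
  by (simp add: height_def)

lemma height_eq_unmatched: "height w = int (unmatched_ups w) - int (unmatched_downs w)"
  by (induction w rule: unmatched_downs.induct) (auto simp: height_Nil height_Cons)

lemma unmatched_downs_eq_0_iff:
  "unmatched_downs w = 0 \<longleftrightarrow> (\<forall>k \<le> length w. 0 \<le> height (take k w))"
proof
  assume w: "unmatched_downs w = 0"
  have "unmatched_downs (take k w) = 0" for k
    using w unmatched_append(1)[of "take k w" "drop k w"] by simp
  then show "\<forall>k \<le> length w. 0 \<le> height (take k w)"
    by (simp add: height_eq_unmatched)
next
  assume "\<forall>k \<le> length w. 0 \<le> height (take k w)"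
  then show "unmatched_downs w = 0"
  proof (induction w rule: rev_induct)
    case (snoc c w)
    have "0 \<le> height (take k w)" if "k \<le> length w" for k
      using snoc.prems[rule_format, of k] that by simp
    then have "unmatched_downs w = 0"
      by (rule_tac snoc.IH) blast
    moreover have "0 \<le> height (w @ [c])"
      using snoc.prems[rule_format, of "length (w @ [c])"] by simp
    ultimately show ?case
      by (cases c) (auto simp: unmatched_append height_append height_Cons height_Nil
          height_eq_unmatched[of w])
  qed simp
qed

lemma dyck_path_iff_unmatched: "dyck_path w \<longleftrightarrow> unmatched_downs w = 0 \<and> unmatched_ups w = 0"
  unfolding dyck_path_def unmatched_downs_eq_0_iff[symmetric]
  by (auto simp: height_eq_unmatched)

text \<open>First-passage decomposition: the leftmost unmatched down-step follows a Dyck path.\<close>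

lemma unmatched_downs_pos_iff:
  "0 < unmatched_downs w \<longleftrightarrow> (\<exists>B C. w = B @ Down # C \<and> dyck_path B)"
proof
  show "0 < unmatched_downs w \<Longrightarrow> \<exists>B C. w = B @ Down # C \<and> dyck_path B"
  proof (induction w rule: rev_induct)
    case (snoc c w)
    show ?case
    proof (cases "unmatched_downs w = 0")
      case True
      with snoc.prems have "c = Down" "dyck_path w"
        by (cases c; simp add: unmatched_append dyck_path_iff_unmatched)+
      then show ?thesis by blast
    next
      case False
      with snoc.IH obtain B C where "w = B @ Down # C" "dyck_path B" by auto
      then show ?thesis by (intro exI[of _ B] exI[of _ "C @ [c]"]) simp
    qed
  qed simp
qed (auto simp: unmatched_append dyck_path_iff_unmatched)

lemma unmatched_ups_pos_iff:
  "0 < unmatched_ups w \<longleftrightarrow> (\<exists>A B. w = A @ Up # B \<and> dyck_path B)"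
proof
  show "0 < unmatched_ups w \<Longrightarrow> \<exists>A B. w = A @ Up # B \<and> dyck_path B"
  proof (induction w)
    case (Cons c w)
    show ?case
    proof (cases "unmatched_ups w = 0")
      case True
      with Cons.prems have "c = Up" "dyck_path w"
        by (cases c; simp add: dyck_path_iff_unmatched split: if_splits)+
      then show ?thesis by blast
    next
      case False
      with Cons.IH obtain A B where "w = A @ Up # B" "dyck_path B" by auto
      then show ?thesis by (intro exI[of _ "c # A"] exI[of _ B]) simp
    qed
  qed simp
qed (auto simp: unmatched_append dyck_path_iff_unmatched)

section \<open>Mirror images\<close>

fun flip :: "step \<Rightarrow> step" where
  "flip Up = Down"
| "flip Down = Up"

lemma flip_flip [simp]: "flip (flip c) = c"
  by (cases c) auto

lemma flip_eq_Up_iff [simp]: "flip c = Up \<longleftrightarrow> c = Down"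
  by (cases c) auto

definition mirror :: "step list \<Rightarrow> step list" where
  "mirror w = rev (map flip w)"

lemma mirror_simps [simp]:
  "mirror [] = []"
  "mirror (c # w) = mirror w @ [flip c]"
  "mirror (v @ w) = mirror w @ mirror v"
  by (simp_all add: mirror_def)

lemma length_mirror [simp]: "length (mirror w) = length w"
  by (simp add: mirror_def)

lemma mirror_mirror [simp]: "mirror (mirror w) = w"
  by (induction w) auto

lemma mirror_eq_iff [simp]: "mirror v = mirror w \<longleftrightarrow> v = w"
  by (metis mirror_mirror)

lemma unmatched_mirror [simp]:
  "unmatched_downs (mirror w) = unmatched_ups w"
  "unmatched_ups (mirror w) = unmatched_downs w"
proof (induction w)
  case (Cons c w)
  { case 1 show ?case using Cons by (cases c) (auto simp: unmatched_append) }
  { case 2 show ?case using Cons by (cases c) (auto simp: unmatched_append) }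
qed auto

lemma dyck_path_mirror [simp]: "dyck_path (mirror w) \<longleftrightarrow> dyck_path w"
  by (auto simp: dyck_path_iff_unmatched)

section \<open>Partners in a Dyck path\<close>

lemma up_down_matchI:
  "dyck_path B \<Longrightarrow> up_down_match (A @ Up # B @ Down # C) (length A + 1) (length A + length B + 2)"
  unfolding up_down_match_def by auto

lemma up_down_match_bounds:
  "up_down_match w p q \<Longrightarrow> 1 \<le> p \<and> p < q \<and> q \<le> length w"
  unfolding up_down_match_def by auto

lemma up_down_match_nth:
  assumes "up_down_match w p q"
  shows "w ! (p - 1) = Up" "w ! (q - 1) = Down"
proof -
  obtain A B C where "w = (A @ Up # B) @ Down # C" "p = length A + 1" "q = length (A @ Up # B) + 1"
    using assms unfolding up_down_match_def by auto
  then show "w ! (p - 1) = Up" "w ! (q - 1) = Down"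
    by (simp, metis nth_append_length diff_add_inverse2)
qed

lemma up_down_match_mirror:
  assumes "up_down_match w p q"
  shows "up_down_match (mirror w) (length w + 1 - q) (length w + 1 - p)"
proof -
  obtain A B C where w: "w = A @ Up # B @ Down # C" "dyck_path B"
    "p = length A + 1" "q = length A + length B + 2"
    using assms unfolding up_down_match_def by auto
  then show ?thesis
    using up_down_matchI[of "mirror B" "mirror C" "mirror A"] by (simp add: add.commute)
qed

lemma matched_mirror:
  "matched w p q \<Longrightarrow> matched (mirror w) (length w + 1 - p) (length w + 1 - q)"
  unfolding matched_def using up_down_match_mirror by blast

lemma up_down_match_Up_iff:
  assumes w: "w = A @ Up # M"
  shows "up_down_match w (length A + 1) q \<longleftrightarrow>
    (\<exists>B C. M = B @ Down # C \<and> dyck_path B \<and> q = length A + length B + 2)"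
proof
  assume "up_down_match w (length A + 1) q"
  then show "\<exists>B C. M = B @ Down # C \<and> dyck_path B \<and> q = length A + length B + 2"
    unfolding up_down_match_def w by fastforce
next
  assume "\<exists>B C. M = B @ Down # C \<and> dyck_path B \<and> q = length A + length B + 2"
  then show "up_down_match w (length A + 1) q"
    using up_down_matchI w by auto
qed

text \<open>
  Applied to the word that follows an up-step, this makes the partner unique: it is the first step that
  leads below the height reached by the up-step.
\<close>

lemma first_passage_unique:
  assumes "B @ Down # C = B' @ Down # C'" "dyck_path B" "dyck_path B'"
  shows "B = B'"
proof -
  \<comment> \<open>A longer \<open>B'\<close> would begin with \<open>B\<close> and a further down-step, which ends below the axis.\<close>
  have no_longer: "X = []" if "dyck_path B" "dyck_path (B @ X)" "X @ Down # C' = Down # C"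
    for B X C C' :: "step list"
    using that by (cases X) (auto simp: unmatched_append dyck_path_iff_unmatched)
  from assms(1) consider X where "B' = B @ X" "X @ Down # C' = Down # C"
    | X where "B = B' @ X" "X @ Down # C = Down # C'"
    unfolding append_eq_append_conv2 by metis
  then show ?thesis
    using no_longer assms(2,3) by cases auto
qed

lemma up_down_match_unique:
  assumes "up_down_match w p q" "up_down_match w p q'"
  shows "q = q'"
proof -
  obtain A B C where w: "w = A @ Up # B @ Down # C" "dyck_path B"
    "p = length A + 1" "q = length A + length B + 2"
    using assms(1) unfolding up_down_match_def by auto
  obtain B' C' where "B @ Down # C = B' @ Down # C'" "dyck_path B'" "q' = length A + length B' + 2"
    using assms(2) up_down_match_Up_iff[OF w(1)] w(3) by auto
  with w show ?thesis using first_passage_unique by blast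
qed

text \<open>A step cannot be both an up-step and a down-step, so the two orientations do not interfere.\<close>

lemma matched_Up_iff:
  assumes "w = A @ Up # M"
  shows "matched w (length A + 1) q \<longleftrightarrow> up_down_match w (length A + 1) q"
  using up_down_match_nth(2)[of w q "length A + 1"] assms by (auto simp: matched_def)

lemma matched_Down_imp_less:
  assumes "w = A @ Down # M" "matched w (length A + 1) q"
  shows "1 \<le> q \<and> q \<le> length A"
  using up_down_match_nth(1)[of w "length A + 1" q] assms
    up_down_match_bounds[of w q "length A + 1"]
  by (auto simp: matched_def)

text \<open>
  An up-step without partner would leave all later heights positive; a down-step without partner
  would lead below the axis.
\<close>

lemma dyck_path_partner_exists:
  assumes w: "w = A @ c # M" and dyck: "dyck_path w"
  shows "\<exists>q. matched w (length A + 1) q"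
proof (cases c)
  case Up
  have "0 < unmatched_downs M"
    using dyck unfolding w Up dyck_path_iff_unmatched
    by (auto simp: unmatched_append split: if_splits)
  then show ?thesis
    using up_down_matchI w Up unfolding unmatched_downs_pos_iff matched_def by fastforce
next
  case Down
  have "0 < unmatched_ups A"
    using dyck unfolding w Down dyck_path_iff_unmatched
    by (auto simp: unmatched_append)
  then obtain A' B where A: "A = A' @ Up # B" "dyck_path B"
    unfolding unmatched_ups_pos_iff by blast
  have "up_down_match w (length A' + 1) (length A + 1)"
    using up_down_matchI[of B A' M] A w Down by simp
  then show ?thesis unfolding matched_def by blast
qed

text \<open>
  With \<open>c # M\<close> the unread factor, the positions already read are those of \<open>A\<close> and \<open>C\<close>. As \<open>c\<close> has exactly one
  partner in \<open>w\<close>, the question is whether that one lies in \<open>M\<close>; the partner of a down-step lies to its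
  left, and that of an up-step is a first passage, which occurs in \<open>M\<close> iff \<open>M\<close> has an unmatched
  down-step.
\<close>

lemma read_partner_first_iff:
  assumes w: "w = A @ (c # M) @ C" and dyck: "dyck_path w"
  shows "(\<exists>q. (1 \<le> q \<and> q \<le> length A \<or> length w - length C < q \<and> q \<le> length w) \<and>
      matched w (length A + 1) q) \<longleftrightarrow> \<not> (c = Up \<and> 0 < unmatched_downs M)"
    (is "?L \<longleftrightarrow> ?R")
proof (cases c)
  case Down
  obtain q where "matched w (length A + 1) q"
    using dyck_path_partner_exists[of w A c "M @ C"] w dyck by auto
  with matched_Down_imp_less[of w A "M @ C" q] w Down show ?thesis by auto
next
  case Up
  have wU: "w = A @ Up # (M @ C)" using w Up by simp
  note m = matched_Up_iff[OF wU]
  show ?thesis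
  proof
    assume ?L
    then obtain q where q: "q \<le> length A \<or> length w - length C < q"
      and mq: "up_down_match w (length A + 1) q"
      using m by blast
    have "\<not> 0 < unmatched_downs M"
    proof
      assume "0 < unmatched_downs M"
      then obtain B C' where B: "M = B @ Down # C'" "dyck_path B"
        unfolding unmatched_downs_pos_iff by blast
      then have "up_down_match w (length A + 1) (length A + length B + 2)"
        using up_down_matchI[of B A "C' @ C"] wU by simp
      with mq have "q = length A + length B + 2" by (rule up_down_match_unique)
      with q B wU show False by simp
    qed
    then show ?R by simp
  next
    assume ?R
    then have none: "unmatched_downs M = 0" using Up by simp
    obtain q where mq: "up_down_match w (length A + 1) q"
      using dyck_path_partner_exists[of w A Up "M @ C"] wU dyck m by blast
    then obtain B C' where B: "M @ C = B @ Down # C'" "dyck_path B" "q = length A + length B + 2"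
      using up_down_match_Up_iff[OF wU] by blast
    have "length M \<le> length B"
    proof (rule ccontr)
      assume less: "\<not> length M \<le> length B"
      then have "M = B @ Down # take (length M - length B - 1) C'"
        using arg_cong[OF B(1), of "take (length M)"] by (simp add: take_Cons')
      with B(2) have "0 < unmatched_downs M" unfolding unmatched_downs_pos_iff by blast
      with none show False by simp
    qed
    then have "length w - length C < q" "q \<le> length w"
      using B(3) wU up_down_match_bounds[OF mq] by auto
    then show ?L using mq m by blast
  qed
qed

lemma read_partner_last_iff:
  assumes w: "w = A @ (M @ [c]) @ C" and dyck: "dyck_path w"
  shows "(\<exists>q. (1 \<le> q \<and> q \<le> length A \<or> length w - length C < q \<and> q \<le> length w) \<and>
      matched w (length w - length C) q) \<longleftrightarrow> \<not> (c = Down \<and> 0 < unmatched_ups M)"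
    (is "(\<exists>q. ?read q \<and> matched w ?p q) \<longleftrightarrow> _")
proof -
  let ?reflect = "\<lambda>q. length w + 1 - q"
  let ?read' = "\<lambda>q. 1 \<le> q \<and> q \<le> length C \<or> length w - length A < q \<and> q \<le> length w"
  have p: "?reflect ?p = length C + 1" "?reflect (length C + 1) = ?p"
    using w by auto
  have "(\<exists>q. ?read q \<and> matched w ?p q) \<longleftrightarrow> (\<exists>q. ?read' q \<and> matched (mirror w) (length C + 1) q)"
  proof
    assume "\<exists>q. ?read q \<and> matched w ?p q"
    then obtain q where q: "?read q" "matched w ?p q" by blast
    have "?read' (?reflect q)" using q(1) w by auto
    then show "\<exists>q. ?read' q \<and> matched (mirror w) (length C + 1) q"
      using matched_mirror[OF q(2)] p by metis
  next
    assume "\<exists>q. ?read' q \<and> matched (mirror w) (length C + 1) q"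
    then obtain q where q: "?read' q" "matched (mirror w) (length C + 1) q" by blast
    have "?read (?reflect q)" using q(1) w by auto
    then show "\<exists>q. ?read q \<and> matched w ?p q"
      using matched_mirror[OF q(2)] p by (metis length_mirror mirror_mirror)
  qed
  also have "\<dots> \<longleftrightarrow> \<not> (c = Down \<and> 0 < unmatched_ups M)"
    using read_partner_first_iff[of "mirror w" "mirror C" "flip c" "mirror M" "mirror A"] dyck
    unfolding length_mirror dyck_path_mirror unmatched_mirror flip_eq_Up_iff by (simp add: w)
  finally show ?thesis .
qed

section \<open>The recursion on the unread factor\<close>

text \<open>
  The argument is the unread factor, oriented so that the next step to be read comes first; after each
  step reading continues at the other end, that is, at the front of the mirror image.
\<close>

function encode :: "step list \<Rightarrow> step list" where
  "encode [] = []"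
| "encode (c # M) = (if c = Up \<and> 0 < unmatched_downs M then Up else Down) # encode (mirror M)"
  by pat_completeness auto
termination by (relation "measure length") auto

lemma length_encode [simp]: "length (encode M) = length M"
  by (induction M rule: encode.induct) auto

text \<open>
  Reading a step whose partner is unread creates an unmatched step in the remaining factor, and
  reading any other step removes one.
\<close>

lemma height_encode: "height (encode M) = - int (unmatched_downs M + unmatched_ups M)"
proof (induction M rule: encode.induct)
  case (2 c M)
  then show ?case by (cases c) (auto simp: height_Cons)
qed (simp add: height_Nil)

lemma drop_encode_eq_encode: "\<exists>N. drop k (encode M) = encode N"
proof (induction M arbitrary: k rule: encode.induct)
  case 1
  show ?case by (rule exI[of _ "[]"]) simp
next
  case (2 c M)
  then show ?case by (cases k) (auto intro: exI[of _ "c # M"])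
qed

text \<open>
  The output ends at height 0, and what remains of it never has positive height, so no prefix has
  negative height.
\<close>

lemma dyck_path_encode:
  assumes "dyck_path w"
  shows "dyck_path (encode w)"
proof -
  have total: "height (encode w) = 0"
    using assms by (simp add: height_encode dyck_path_iff_unmatched)
  have "0 \<le> height (take k (encode w))" for k
  proof -
    obtain N where "drop k (encode w) = encode N" using drop_encode_eq_encode by blast
    then have "height (drop k (encode w)) \<le> 0" by (simp add: height_encode)
    with total show ?thesis
      using height_append[of "take k (encode w)" "drop k (encode w)"] by simp
  qed
  with total show ?thesis by (simp add: dyck_path_def)
qed

text \<open>
  If the output is \<open>Down\<close>, the first letter is unmatched in its factor; it is \<open>Down\<close> exactly when
  the factor has unmatched down-steps, since these stand to the left of all unmatched up-steps.
\<close>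

lemma encode_inject:
  assumes "encode M = encode N"
    and "unmatched_downs M = unmatched_downs N" "unmatched_ups M = unmatched_ups N"
  shows "M = N"
  using assms
proof (induction M arbitrary: N rule: encode.induct)
  case 1
  then show ?case by (cases N) auto
next
  case (2 c M)
  then obtain c' N' where N: "N = c' # N'" by (cases N) auto
  have "c = c' \<and> unmatched_downs M = unmatched_downs N' \<and> unmatched_ups M = unmatched_ups N'"
    using "2.prems" unfolding N by (cases c; cases c') (auto split: if_splits)
  with "2.IH"[of "mirror N'"] "2.prems" N show ?case by auto
qed

section \<open>\<open>Phi\<close> follows the recursion\<close>

text \<open>The positions read in the first \<open>k\<close> rounds form a prefix and a suffix.\<close>

lemma sigma_image:
  assumes "k \<le> 2 * n"
  shows "(\<exists>j. 1 \<le> j \<and> j < k + 1 \<and> sigma n j = q) \<longleftrightarrow>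
    1 \<le> q \<and> q \<le> (k + 1) div 2 \<or> 2 * n - k div 2 < q \<and> q \<le> 2 * n" (is "?L \<longleftrightarrow> ?R")
proof
  assume ?L
  then obtain j where j: "1 \<le> j" "j \<le> k" "sigma n j = q" by auto
  show ?R
  proof (cases "odd j")
    case True
    then have "q = (j + 1) div 2" using j(3) by (simp add: sigma_def)
    then show ?thesis using j by auto
  next
    case False
    then obtain i where "j = 2 * i" by (auto elim: evenE)
    then show ?thesis using j assms by (auto simp: sigma_def)
  qed
next
  assume ?R
  then show ?L
  proof (elim disjE)
    assume "1 \<le> q \<and> q \<le> (k + 1) div 2"
    then show ?L by (intro exI[of _ "2 * q - 1"]) (auto simp: sigma_def)
  next
    assume "2 * n - k div 2 < q \<and> q \<le> 2 * n"
    then show ?L using assms by (intro exI[of _ "2 * (2 * n + 1 - q)"]) (auto simp: sigma_def)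
  qed
qed

lemma length_Phi [simp]: "length (Phi n w) = 2 * n"
  by (simp add: Phi_def)

lemma Phi_nth:
  assumes "k < 2 * n"
  shows "Phi n w ! k =
    (if \<exists>q. (1 \<le> q \<and> q \<le> (k + 1) div 2 \<or> 2 * n - k div 2 < q \<and> q \<le> 2 * n) \<and>
          matched w (sigma n (k + 1)) q
     then Down else Up)"
proof -
  have "(\<exists>j. 1 \<le> j \<and> j < k + 1 \<and> matched w (sigma n (k + 1)) (sigma n j)) \<longleftrightarrow>
    (\<exists>q. (1 \<le> q \<and> q \<le> (k + 1) div 2 \<or> 2 * n - k div 2 < q \<and> q \<le> 2 * n) \<and>
          matched w (sigma n (k + 1)) q)"
    using sigma_image[of k n] assms by (metis less_imp_le)
  moreover have "k < length [1..<2 * n + 1]" "[1..<2 * n + 1] ! k = k + 1"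
    using assms by (simp_all del: upt_Suc)
  ultimately show ?thesis unfolding Phi_def by simp
qed

text \<open>
  The two cases are the two kinds of unread factor: after an even number of steps as many have been
  read on the left as on the right, after an odd number one more on the left.
\<close>

lemma drop_Phi_eq_encode:
  assumes "dyck_path w" "length w = 2 * n" "w = A @ M @ C"
  shows "(length A = length C \<longrightarrow> drop (length A + length C) (Phi n w) = encode M) \<and>
    (length A = Suc (length C) \<longrightarrow> drop (length A + length C) (Phi n w) = encode (mirror M))"
  using assms(3)
proof (induction "length M" arbitrary: A M C)
  case 0
  then show ?case using assms(2) by simp
next
  case (Suc l)
  let ?k = "length A + length C"
  have k: "?k < 2 * n" using Suc.hyps(2) Suc.prems assms(2) by auto
  then have step: "drop ?k (Phi n w) = Phi n w ! ?k # drop (Suc ?k) (Phi n w)"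
    by (simp add: Cons_nth_drop_Suc)
  show ?case
  proof (intro conjI impI)
    assume eq: "length A = length C"
    obtain c M' where M: "M = c # M'" using Suc.hyps(2) by (cases M) auto
    have "drop (Suc ?k) (Phi n w) = encode (mirror M')"
      using Suc.hyps(1)[of M' "A @ [c]" C] Suc.hyps(2) Suc.prems M eq by simp
    moreover have "Phi n w ! ?k = (if c = Up \<and> 0 < unmatched_downs M' then Up else Down)"
    proof -
      have "sigma n (?k + 1) = length A + 1" "(?k + 1) div 2 = length A" "?k div 2 = length C"
        using eq by (simp_all add: sigma_def)
      moreover have "w = A @ (c # M') @ C"
        using Suc.prems M by simp
      note read_partner_first_iff[OF this assms(1), unfolded assms(2)]
      ultimately show ?thesis
        unfolding Phi_nth[OF k] by simp
    qed
    ultimately show "drop ?k (Phi n w) = encode M" using step M by simp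
  next
    assume eq: "length A = Suc (length C)"
    obtain c M' where M: "M = M' @ [c]" using Suc.hyps(2) by (cases M rule: rev_cases) auto
    have "drop (Suc ?k) (Phi n w) = encode M'"
      using Suc.hyps(1)[of M' A "c # C"] Suc.hyps(2) Suc.prems M eq by simp
    moreover have "Phi n w ! ?k = (if c = Down \<and> 0 < unmatched_ups M' then Up else Down)"
    proof -
      have "sigma n (?k + 1) = 2 * n - length C" "(?k + 1) div 2 = length A" "?k div 2 = length C"
        using eq by (simp_all add: sigma_def)
      moreover have "w = A @ (M' @ [c]) @ C"
        using Suc.prems M by simp
      note read_partner_last_iff[OF this assms(1), unfolded assms(2)]
      ultimately show ?thesis
        unfolding Phi_nth[OF k] by simp
    qed
    ultimately show "drop ?k (Phi n w) = encode (mirror M)" using step M by simp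
  qed
qed

lemma Phi_eq_encode:
  assumes "w \<in> dyck_paths n"
  shows "Phi n w = encode w"
  using drop_Phi_eq_encode[of w n "[]" w "[]"] assms by (simp add: dyck_paths_def)

lemma finite_dyck_paths: "finite (dyck_paths n)"
proof -
  have "(UNIV :: step set) = {Up, Down}" using step.exhaust by auto
  then have "finite {w :: step list. set w \<subseteq> UNIV \<and> length w = 2 * n}"
    by (metis finite_lists_length_eq finite.emptyI finite.insertI)
  then show ?thesis by (rule rev_finite_subset) (auto simp: dyck_paths_def)
qed

theorem mainTheorem1:
  fixes n :: nat
  shows "bij_betw (Phi n) (dyck_paths n) (dyck_paths n)"
proof -
  have inj: "inj_on (Phi n) (dyck_paths n)"
    by (rule inj_onI)
      (auto simp: Phi_eq_encode dyck_paths_def dyck_path_iff_unmatched intro: encode_inject)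
  have "Phi n ` dyck_paths n \<subseteq> dyck_paths n"
    by (auto simp: Phi_eq_encode) (auto simp: dyck_paths_def dyck_path_encode)
  then have "Phi n ` dyck_paths n = dyck_paths n"
    using inj by (rule endo_inj_surj[OF finite_dyck_paths])
  with inj show ?thesis by (simp add: bij_betw_def)
qed

end
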